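(* Let $c,r,n$ be positive integers with $2<r<2c$. Then $R^c(B^rK_n)\ge 1+c\left\lfloor \frac{n-2}{c-1}\right\rfloor$.
   Context: An $r$-uniform hypergraph ($r$-graph) consists of a vertex set and a set of $r$-element subsets of it (hyperedges); $\mathcal{K}_N^r$ denotes the complete $r$-graph on $N$ vertices and $K_n$ the complete graph on $n$ vertices. For a graph $F$, an $r$-graph $\mathcal{H}$ contains a Berge-$F$ if there are an injection $\varphi:V(F)\to V(\mathcal{H})$ and an injection $f$ from $E(F)$ to the hyperedges of $\mathcal{H}$ with $\{\varphi(x),\varphi(y)\}\subseteq f(xy)$ for every edge $xy$; $B^rF$ is the family of $r$-uniform Berge copies of $F$. A $c$-coloring assigns to each hyperedge one of the colors $1,\dots,c$. $R^c(B^rK_n)$ is the smallest $N$ such that in every $c$-coloring of $\mathcal{K}_N^r$ the hyperedges of some single color contain a Berge-$K_n$. *)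

theory Defs
  imports Complex_Main "HOL-Library.Ramsey"
begin

(* A hypergraph is a pair (vertex set, set of hyperedges); graphs are the 2-uniform case. *)
type_synonym 'a hypergraph = "'a set \<times> 'a set set"

definition complete_hypergraph :: "nat \<Rightarrow> nat \<Rightarrow> nat hypergraph" where
  "complete_hypergraph r N = ({..<N}, nsets {..<N} r)"

abbreviation complete_graph :: "nat \<Rightarrow> nat hypergraph" where
  "complete_graph n \<equiv> complete_hypergraph 2 n"

definition contains_Berge :: "'a hypergraph \<Rightarrow> 'b hypergraph \<Rightarrow> bool" where
  "contains_Berge H F \<longleftrightarrow>
     (\<exists>\<phi> f. inj_on \<phi> (fst F) \<and> \<phi> ` fst F \<subseteq> fst H \<and>
            inj_on f (snd F) \<and> f ` snd F \<subseteq> snd H \<and>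
            (\<forall>e \<in> snd F. \<phi> ` e \<subseteq> f e))"

(* A colour class keeps the whole vertex set, including vertices in no hyperedge of that colour. *)
definition colour_class :: "'a hypergraph \<Rightarrow> ('a set \<Rightarrow> nat) \<Rightarrow> nat \<Rightarrow> 'a hypergraph" where
  "colour_class H \<chi> i = (fst H, {e \<in> snd H. \<chi> e = i})"

definition Berge_arrows :: "nat \<Rightarrow> nat \<Rightarrow> nat \<Rightarrow> 'b hypergraph \<Rightarrow> bool" where
  "Berge_arrows c r N F \<longleftrightarrow>
     (\<forall>\<chi> \<in> snd (complete_hypergraph r N) \<rightarrow> {1..c}.
        \<exists>i \<in> {1..c}. contains_Berge (colour_class (complete_hypergraph r N) \<chi> i) F)"

(* LEAST is meaningful for finite F, c >= 1 and r >= 2: some N with the arrowing property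
   then exists by Ramsey's theorem for r-uniform hypergraphs, since a sufficiently large
   complete r-uniform hypergraph contains a Berge copy of F. *)
definition Berge_Ramsey :: "nat \<Rightarrow> nat \<Rightarrow> 'b hypergraph \<Rightarrow> nat" where
  "Berge_Ramsey c r F = (LEAST N. Berge_arrows c r N F)"

end

(* Lower bound: let N <= c * m with m = floor ((n - 2) / (c - 1)), and split the N vertices into
   the residue classes modulo c, of size at most m. As r < 2 * c, every hyperedge meets some
   class in at most one vertex; colour it by such a class. In colour i, no hyperedge contains two
   vertices of class i, so the core of a monochromatic Berge copy has at most one vertex there,
   hence at most 1 + (c - 1) * m <= n - 1 vertices altogether.

   Since the Ramsey number is a LEAST, the lower bound also needs that some N has the arrowing
   property. This is Ramsey's theorem: a monochromatic complete r-graph on n + (r - 2) vertices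
   contains a Berge copy of the complete graph on n of them, each edge being enlarged by
   the r - 2 remaining vertices. *)
theory Submission
  imports Defs
begin

lemma contains_Berge_complete_graph:
  assumes "2 \<le> r" "finite A" "card A = n + (r - 2)" "A \<subseteq> fst H" "nsets A r \<subseteq> snd H"
  shows "contains_Berge H (complete_graph n)"
proof -
  obtain h where h: "bij_betw h {..<n + (r - 2)} A"
    using ex_bij_betw_nat_finite[OF assms(2)] assms(3) by (auto simp: atLeast0LessThan)
  \<comment> \<open>All edges receive the same r - 2 extra vertices. These lie outside
    \<open>{..<n}\<close>, so intersecting with \<open>{..<n}\<close> recovers the edge; this makes
    \<open>f\<close> injective.\<close>
  define pad where "pad e = e \<union> {n..<n + (r - 2)}" for e
  define f where "f e = h ` pad e" for e
  have pad_sub: "pad e \<subseteq> {..<n + (r - 2)}" if "e \<in> nsets {..<n} 2" for e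
    using that by (auto simp: nsets_def pad_def)
  have inj_h: "inj_on h {..<n + (r - 2)}" and im_h: "h ` {..<n + (r - 2)} = A"
    using h by (auto simp: bij_betw_def)
  have pad_nsets: "pad e \<in> nsets {..<n + (r - 2)} r" if "e \<in> nsets {..<n} 2" for e
  proof -
    have e: "e \<subseteq> {..<n}" "finite e" "card e = 2"
      using that by (auto simp: nsets_def)
    then have "card (pad e) = card e + card {n..<n + (r - 2)}"
      unfolding pad_def by (intro card_Un_disjoint) auto
    then show ?thesis
      using e pad_sub[OF that] assms(1) by (auto simp: nsets_def pad_def)
  qed
  have "f ` nsets {..<n} 2 \<subseteq> nsets A r"
  proof
    fix x assume "x \<in> f ` nsets {..<n} 2"
    then obtain e where e: "e \<in> nsets {..<n} 2" "x = h ` pad e"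
      by (auto simp: f_def)
    have "card (h ` pad e) = card (pad e)"
      using inj_h pad_sub[OF e(1)] by (meson card_image inj_on_subset)
    then show "x \<in> nsets A r"
      using pad_nsets[OF e(1)] e(2) im_h by (auto simp: nsets_def)
  qed
  moreover have "inj_on f (nsets {..<n} 2)"
  proof (rule inj_onI)
    fix d e assume d: "d \<in> nsets {..<n} 2" and e: "e \<in> nsets {..<n} 2" and "f d = f e"
    then have "pad d = pad e"
      using inj_on_image_eq_iff[OF inj_h pad_sub pad_sub] by (simp add: f_def)
    then have "pad d \<inter> {..<n} = pad e \<inter> {..<n}"
      by simp
    moreover have "pad u \<inter> {..<n} = u" if "u \<in> nsets {..<n} 2" for u
      using that by (auto simp: nsets_def pad_def)
    ultimately show "d = e"
      using d e by simp
  qed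
  moreover have "inj_on h {..<n}"
    using inj_h by (rule inj_on_subset) auto
  moreover have "h ` {..<n} \<subseteq> fst H"
    using im_h assms(4) by auto
  moreover have "h ` e \<subseteq> f e" for e
    by (auto simp: f_def pad_def)
  ultimately show ?thesis
    unfolding contains_Berge_def complete_hypergraph_def using assms(5)
    by (intro exI[of _ h] exI[of _ f]) auto
qed

lemma ex_Berge_arrows:
  assumes "2 \<le> r"
  shows "\<exists>N. Berge_arrows c r N (complete_graph n)"
proof -
  obtain N where N: "partn_lst {..<N::nat} (replicate c (n + (r - 2))) r"
    using ramsey_full by blast
  have "Berge_arrows c r N (complete_graph n)"
    unfolding Berge_arrows_def
  proof
    fix \<chi> assume "\<chi> \<in> snd (complete_hypergraph r N) \<rightarrow> {1..c}"
    then have chi: "1 \<le> \<chi> e \<and> \<chi> e \<le> c" if "e \<in> nsets {..<N} r" for e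
      using that by (auto simp: complete_hypergraph_def)
    \<comment> \<open>\<open>partn_lst\<close> numbers colours from 0, hence the shift. As every
      colour is at least 1, the truncated subtraction can be undone below.\<close>
    have "(\<lambda>e. \<chi> e - 1) \<in> nsets {..<N} r \<rightarrow> {..<c}"
      using chi by (fastforce simp: less_eq_Suc_le)
    then obtain i A where i: "i < c" "A \<in> nsets {..<N} (n + (r - 2))"
        "(\<lambda>e. \<chi> e - 1) ` nsets A r \<subseteq> {i}"
      using partn_lstE[OF N, of _ c] by (metis length_replicate nth_replicate)
    have A: "A \<subseteq> {..<N}" "finite A" "card A = n + (r - 2)"
      using i(2) by (auto simp: nsets_def)
    have "nsets A r \<subseteq> {e \<in> nsets {..<N} r. \<chi> e = Suc i}"
    proof
      fix e assume e: "e \<in> nsets A r"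
      then have "e \<in> nsets {..<N} r"
        using nsets_mono[OF A(1)] by blast
      moreover have "\<chi> e - 1 = i"
        using i(3) e by auto
      ultimately show "e \<in> {e \<in> nsets {..<N} r. \<chi> e = Suc i}"
        using chi by fastforce
    qed
    then have "contains_Berge (colour_class (complete_hypergraph r N) \<chi> (Suc i)) (complete_graph n)"
      using A assms
      by (intro contains_Berge_complete_graph) (auto simp: colour_class_def complete_hypergraph_def)
    then show "\<exists>i\<in>{1..c}. contains_Berge (colour_class (complete_hypergraph r N) \<chi> i) (complete_graph n)"
      using i(1) by (intro bexI[of _ "Suc i"]) auto
  qed
  then show ?thesis ..
qed

text \<open>Pigeonhole: the c residue classes partition \<open>e\<close>, so two elements in each of
  them would force \<open>card e\<close> to be at least 2 * c.\<close>

lemma ex_residue_class_card_le_1: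
  fixes e :: "nat set"
  assumes "finite e" "card e < 2 * c"
  shows "\<exists>i<c. card {v \<in> e. v mod c = i} \<le> 1"
proof (rule ccontr)
  assume "\<not> ?thesis"
  then have "(\<Sum>i<c. 2::nat) \<le> (\<Sum>i<c. card {v \<in> e. v mod c = i})"
    by (intro sum_mono) (auto simp: not_le)
  moreover have "(\<Sum>i<c. card {v \<in> e. v mod c = i}) = card e"
    using sum.group[of e "{..<c}" "\<lambda>v. v mod c" "\<lambda>_. 1::nat"] assms
    by (auto simp: image_subset_iff)
  ultimately show False
    using assms(2) by simp
qed

text \<open>A number v is determined by its remainder and quotient modulo c. Here the remainder
  avoids i, leaving c - 1 values, and v < c * m leaves m quotients.\<close>

lemma card_off_residue_class_le:
  assumes "N \<le> c * m" "i < (c::nat)"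
  shows "card {v \<in> {..<N}. v mod c \<noteq> i} \<le> (c - 1) * m"
proof -
  have "card {v \<in> {..<N}. v mod c \<noteq> i} \<le> card (({..<c} - {i}) \<times> {..<m})"
  proof (rule card_inj_on_le)
    show "inj_on (\<lambda>v. (v mod c, v div c)) {v \<in> {..<N}. v mod c \<noteq> i}"
      by (rule inj_onI) (metis div_mult_mod_eq prod.inject)
    show "(\<lambda>v. (v mod c, v div c)) ` {v \<in> {..<N}. v mod c \<noteq> i} \<subseteq> ({..<c} - {i}) \<times> {..<m}"
      using assms by (auto simp: less_mult_imp_div_less mult.commute)
  qed simp
  then show ?thesis
    using assms(2) by simp
qed

lemma not_Berge_arrows_complete_graph:
  assumes "r < 2 * c" "N \<le> c * m" "1 + (c - 1) * m < n"
  shows "\<not> Berge_arrows c r N (complete_graph n)"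
proof
  assume arrows: "Berge_arrows c r N (complete_graph n)"
  define light where "light e i \<longleftrightarrow> i < c \<and> card {v \<in> e. v mod c = i} \<le> 1" for e :: "nat set" and i
  \<comment> \<open>Residues start at 0 and colours at 1, so colour j belongs to the residue class j
    - 1.\<close>
  define \<chi> where "\<chi> e = Suc (SOME i. light e i)" for e
  have light: "light e (\<chi> e - 1)" if "e \<in> nsets {..<N} r" for e
  proof -
    have "\<exists>i. light e i"
      using ex_residue_class_card_le_1[of e c] that assms(1) by (auto simp: nsets_def light_def)
    then show ?thesis
      unfolding \<chi>_def by (simp add: someI_ex)
  qed
  have "\<chi> e \<in> {1..c}" if "e \<in> nsets {..<N} r" for e
    using light[OF that] by (auto simp: light_def \<chi>_def)
  then have "\<chi> \<in> snd (complete_hypergraph r N) \<rightarrow> {1..c}"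
    by (auto simp: complete_hypergraph_def)
  with arrows obtain j where j: "j \<in> {1..c}"
      "contains_Berge (colour_class (complete_hypergraph r N) \<chi> j) (complete_graph n)"
    unfolding Berge_arrows_def by blast
  then obtain \<phi> f where phi: "inj_on \<phi> {..<n}" "\<phi> ` {..<n} \<subseteq> {..<N}"
    and f: "\<And>e. e \<in> nsets {..<n} 2 \<Longrightarrow> f e \<in> nsets {..<N} r \<and> \<chi> (f e) = j \<and> \<phi> ` e \<subseteq> f e"
    by (fastforce simp: contains_Berge_def colour_class_def complete_hypergraph_def)
  define i where "i = j - 1"
  have "i < c"
    using j(1) by (auto simp: i_def)
  define C where "C = {v \<in> \<phi> ` {..<n}. v mod c = i}"
  \<comment> \<open>Any two core vertices are joined by an edge of the complete graph. Its hyperedge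
    has colour j and contains both, so they cannot both lie in the class that colour j meets at most
    once.\<close>
  have "x = y" if C: "x \<in> C" "y \<in> C" for x y
  proof (rule ccontr)
    assume "x \<noteq> y"
    obtain a b where ab: "a < n" "b < n" "x = \<phi> a" "y = \<phi> b"
      using C by (auto simp: C_def)
    then have fe: "f {a, b} \<in> nsets {..<N} r" "\<chi> (f {a, b}) = j" "{x, y} \<subseteq> f {a, b}"
      using f[of "{a, b}"] \<open>x \<noteq> y\<close> by auto
    then have "card {v \<in> f {a, b}. v mod c = i} \<le> 1"
      using light[of "f {a, b}"] by (simp add: light_def i_def)
    moreover have "card {x, y} \<le> card {v \<in> f {a, b}. v mod c = i}"
      using fe C by (intro card_mono) (auto simp: nsets_def C_def)
    ultimately show False
      using \<open>x \<noteq> y\<close> by simp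
  qed
  moreover have "finite C"
    by (simp add: C_def)
  ultimately have "card C \<le> 1"
    unfolding One_nat_def using card_le_Suc0_iff_eq by blast
  have "n = card (\<phi> ` {..<n})"
    using phi(1) by (simp add: card_image)
  also have "\<dots> \<le> card (C \<union> {v \<in> {..<N}. v mod c \<noteq> i})"
    using phi(2) by (intro card_mono) (auto simp: C_def)
  also have "\<dots> \<le> card C + card {v \<in> {..<N}. v mod c \<noteq> i}"
    by (rule card_Un_le)
  also have "\<dots> \<le> 1 + (c - 1) * m"
    using \<open>card C \<le> 1\<close> card_off_residue_class_le[OF assms(2) \<open>i < c\<close>] by linarith
  finally show False
    using assms(3) by simp
qed

theorem theorem3:
  fixes c r n :: nat
  assumes "0 < c" and "0 < r" and "0 < n"
    and "2 < r" and "r < 2 * c"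
  shows "int (Berge_Ramsey c r (complete_graph n))
           \<ge> 1 + int c * \<lfloor>(real n - 2) / (real c - 1)\<rfloor>"
proof -
  define q where "q = \<lfloor>(real n - 2) / (real c - 1)\<rfloor>"
  have c: "2 \<le> c"
    using assms(4,5) by linarith
  show ?thesis
  proof (cases "0 \<le> q")
    case True
    define m where "m = nat q"
    have "real m \<le> (real n - 2) / (real c - 1)"
      using True by (simp add: m_def q_def)
    then have "real m * (real c - 1) \<le> real n - 2"
      using c by (simp add: field_simps)
    moreover have "real ((c - 1) * m) = real m * (real c - 1)"
      using c by simp
    \<comment> \<open>The 2 pays for the single core vertex in the colour's own class and for the
      strictness of the next inequality.\<close>
    ultimately have "real ((c - 1) * m) + 2 \<le> real n"
      by linarith
    then have "1 + (c - 1) * m < n"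
      by linarith
    then have "\<not> Berge_arrows c r N (complete_graph n)" if "N \<le> c * m" for N
      using not_Berge_arrows_complete_graph assms(5) that by blast
    \<comment> \<open>The least N is itself an arrowing number, so it cannot be among the N \<le> c
      * m just excluded.\<close>
    moreover have "Berge_arrows c r (Berge_Ramsey c r (complete_graph n)) (complete_graph n)"
      unfolding Berge_Ramsey_def using ex_Berge_arrows[of r c n] assms(4) by (auto intro: LeastI_ex)
    ultimately have "c * m < Berge_Ramsey c r (complete_graph n)"
      using not_le by blast
    then have "1 + int (c * m) \<le> int (Berge_Ramsey c r (complete_graph n))"
      by linarith
    then show ?thesis
      using True by (simp add: m_def q_def)
  next
    case False
    \<comment> \<open>The floor is negative only for n = 1. Then q \<le> -1, and the claimed bound
      is at most 1 - c, which is negative.\<close>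
    then have "int c * q \<le> int c * (-1)"
      by (intro mult_left_mono) auto
    then show ?thesis
      using c by (simp add: q_def)
  qed
qed

end
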